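(* Let $k$ be a field of characteristic $p\ge5$. Let $r\ge1$ be an integer and let $\varrho:(\mathbb{Z}/p\mathbb{Z})^r\to GL(4,k)$ be a (modular) representation. Then $\varrho$ is equivalent to a representation $\varrho':(\mathbb{Z}/p\mathbb{Z})^r\to GL(4,k)$ such that the matrices $\varrho'(e_i)$ $(1\le i\le r)$ have (simultaneously for all $i$) one of the following forms (1), (2), (3), (4), (5), (6), (7), with $\alpha_i,\beta_i,\gamma_i,\delta_i\in k$: (1) $\begin{pmatrix}1&\alpha_i&\beta_i&\gamma_i\\0&1&\alpha_i&\beta_i\\0&0&1&\alpha_i\\0&0&0&1\end{pmatrix}$ $(1\le i\le r)$. (2) $\begin{pmatrix}1&\alpha_i&\beta_i&\gamma_i\\0&1&\alpha_i&0\\0&0&1&0\\0&0&0&1\end{pmatrix}$ $(1\le i\le r)$. (3) $\begin{pmatrix}1&0&0&\gamma_i\\0&1&\alpha_i&\beta_i\\0&0&1&\alpha_i\\0&0&0&1\end{pmatrix}$ $(1\le i\le r)$. (4) $\begin{pmatrix}1&\alpha_i&\beta_i&\gamma_i\\0&1&0&0\\0&0&1&0\\0&0&0&1\end{pmatrix}$ $(1\le i\le r)$. (5) $\begin{pmatrix}1&0&\alpha_i&\beta_i\\0&1&\gamma_i&\delta_i\\0&0&1&0\\0&0&0&1\end{pmatrix}$ $(1\le i\le r)$. (6) $\begin{pmatrix}1&0&0&\alpha_i\\0&1&0&\beta_i\\0&0&1&\gamma_i\\0&0&0&1\end{pmatrix}$ $(1\le i\le r)$. (7) $\begin{pmatrix}1&\alpha_i&\beta_i&\gamma_i\\0&1&0&\lambda\alpha_i+\mu\beta_i\\0&0&1&\mu\alpha_i+\nu\beta_i\\0&0&0&1\end{pmatrix}$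 $(1\le i\le r)$, having constants $\lambda,\mu,\nu\in k$ (independent of $i$) with $\lambda\nu-\mu^2\ne0$.
   Context: $e_1,\dots,e_r$ are the standard generators of $(\mathbb{Z}/p\mathbb{Z})^r$ ($e_i$ has $i$-th entry $[1]$ and other entries $[0]$). Representations $\varrho,\varrho'$ into $GL(4,k)$ are equivalent if there is $P\in GL(4,k)$ with $P^{-1}\varrho(g)P=\varrho'(g)$ for all $g$. (Every representation of $(\mathbb{Z}/p\mathbb{Z})^r$, $r\ge1$, over a field of characteristic $p$ is modular, i.e. $p$ divides the group order.) *)

theory Defs
  imports "HOL-Analysis.Analysis" "HOL-Algebra.Product_Groups"
begin

definition elem_ab :: "nat \<Rightarrow> nat \<Rightarrow> (nat \<Rightarrow> int) monoid" where
  "elem_ab p r = product_group {1..r} (\<lambda>_. integer_mod_group p)"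

(* The entry [1] is represented by 1 mod p, the carrier of integer_mod_group p being {0..<p}
   for p > 0. The function is undefined outside {1..r}, as required by product_group. *)
definition std_gen :: "nat \<Rightarrow> nat \<Rightarrow> nat \<Rightarrow> nat \<Rightarrow> int" where
  "std_gen p r i = (\<lambda>j\<in>{1..r}. if j = i then 1 mod int p else 0)"

definition GL :: "('k::field ^ 'n ^ 'n) monoid" where
  "GL = \<lparr>carrier = {A. invertible A}, monoid.mult = (**), one = mat 1\<rparr>"

definition equivalent_rep ::
  "('g, 'b) monoid_scheme \<Rightarrow> ('g \<Rightarrow> 'k::field ^ 'n ^ 'n) \<Rightarrow> ('g \<Rightarrow> 'k ^ 'n ^ 'n) \<Rightarrow> bool" where
  "equivalent_rep G \<rho> \<rho>' \<longleftrightarrow>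
     (\<exists>P. invertible P \<and> (\<forall>g\<in>carrier G. matrix_inv P ** \<rho> g ** P = \<rho>' g))"

lemma group_elem_ab: "group (elem_ab p r)"
  unfolding elem_ab_def by simp

lemma std_gen_in_carrier: "std_gen p r i \<in> carrier (elem_ab p r)"
  by (auto simp: std_gen_def elem_ab_def carrier_integer_mod_group PiE_iff)

lemma group_GL: "group (GL :: ('k::field ^ 'n ^ 'n) monoid)"
proof (rule groupI)
  fix A :: "'k ^ 'n ^ 'n"
  assume "A \<in> carrier GL"
  then obtain B where "A ** B = mat 1" "B ** A = mat 1"
    by (auto simp: GL_def invertible_def)
  then show "\<exists>B\<in>carrier GL. B \<otimes>\<^bsub>GL\<^esub> A = \<one>\<^bsub>GL\<^esub>"
    by (intro bexI[of _ B]) (auto simp: GL_def invertible_def)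
next
  show "\<one>\<^bsub>GL\<^esub> \<in> carrier (GL :: ('k ^ 'n ^ 'n) monoid)"
    by (auto simp: GL_def invertible_def intro!: exI[of _ "mat 1"])
qed (auto simp: GL_def invertible_mult matrix_mul_assoc)

end

theory Submission
  imports Defs
begin

text \<open>
  The matrices \<open>\<rho> g - 1\<close> commute, and they are nilpotent since \<open>(\<rho> g)\<^sup>p = 1\<close> in characteristic
  \<open>p\<close>. If one of them has a nonzero cube, it is a single Jordan block and everything commuting with
  it is a polynomial in it: form (1). If all cubes vanish but some square does not, that element has
  Jordan type (3, 1), and its centralizer leads to forms (2), (3) and (7). If all squares vanish, then
  all products vanish because \<open>p \<noteq> 2\<close>, and a basis adapted to the common kernel, which contains all
  images, gives form (4), (5) or (6) according to its dimension.
\<close>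

section \<open>Bases of a four-dimensional space as columns of a matrix\<close>

definition cols4 :: "'k::field^4 \<Rightarrow> 'k^4 \<Rightarrow> 'k^4 \<Rightarrow> 'k^4 \<Rightarrow> 'k^4^4" where
  "cols4 a b c d = transpose (vector [a, b, c, d])"

lemma vector_4 [simp]:
  "(vector [x, y, z, w] :: 'a::zero^4) $ 1 = x" "(vector [x, y, z, w] :: 'a^4) $ 2 = y"
  "(vector [x, y, z, w] :: 'a^4) $ 3 = z" "(vector [x, y, z, w] :: 'a^4) $ 4 = w"
  unfolding vector_def by simp_all

lemma cols4_nth [simp]:
  "cols4 a b c d $ i $ 1 = a $ i" "cols4 a b c d $ i $ 2 = b $ i"
  "cols4 a b c d $ i $ 3 = c $ i" "cols4 a b c d $ i $ 4 = d $ i"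
  by (simp_all add: cols4_def transpose_def)

lemma cols4_eqI:
  assumes "\<And>i. A $ i $ 1 = a $ i" "\<And>i. A $ i $ 2 = b $ i"
    "\<And>i. A $ i $ 3 = c $ i" "\<And>i. A $ i $ 4 = d $ i"
  shows "A = cols4 a b c d"
  by (simp only: vec_eq_iff forall_4 assms cols4_nth simp_thms)

lemma cols4_mult_vec:
  "cols4 a b c d *v w = w $ 1 *s a + w $ 2 *s b + w $ 3 *s c + w $ 4 *s d"
  by (simp add: vec_eq_iff matrix_vector_mult_def sum_4 mult.commute)

lemma columns_cols4: "columns (cols4 a b c d) = {a, b, c, d}"
proof -
  have "columns (cols4 a b c d) = (\<lambda>j. column j (cols4 a b c d)) ` {1, 2, 3, 4}"
    unfolding columns_def UNIV_4[symmetric] by auto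
  then show ?thesis by (simp add: column_def)
qed

lemma mult_cols4: "A ** cols4 a b c d = cols4 (A *v a) (A *v b) (A *v c) (A *v d)"
  by (rule cols4_eqI) (simp_all add: matrix_matrix_mult_def matrix_vector_mult_def)

text \<open>Together with \<open>mult_cols4\<close> this reduces \<open>A ** P = P ** M\<close>, for
  \<open>P\<close> with the basis vectors as columns, to a comparison of columns: column j of
  \<open>M\<close> must hold the coordinates of the image of the j-th basis vector. Normal forms are
  thus checked without computing an inverse.\<close>

lemma cols4_mult:
  "cols4 a b c d ** vector [vector [m11, m12, m13, m14], vector [m21, m22, m23, m24],
     vector [m31, m32, m33, m34], vector [m41, m42, m43, m44]] =
   cols4 (m11 *s a + m21 *s b + m31 *s c + m41 *s d) (m12 *s a + m22 *s b + m32 *s c + m42 *s d)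
     (m13 *s a + m23 *s b + m33 *s c + m43 *s d) (m14 *s a + m24 *s b + m34 *s c + m44 *s d)"
  by (rule cols4_eqI) (simp_all add: matrix_matrix_mult_def sum_4 mult.commute)

lemma invertible_cols4:
  assumes "vec.independent {a, b, c, d}" "card {a, b, c, d} = 4"
  shows "invertible (cols4 a b c d)"
proof -
  have "vec.span {a, b, c, d} = UNIV"
    using vec.card_eq_dim[of "{a, b, c, d}" UNIV] assms
    by (simp add: card_cart_basis top.extremum_unique)
  then show ?thesis
    by (simp add: invertible_right_inverse matrix_right_invertible_span_columns columns_cols4)
qed

text \<open>Each vector lies outside the span of its predecessors. The cardinality is a separate
  conclusion because a listed set of four vectors could collapse; \<open>invertible_cols4\<close>
  compares it with the dimension.\<close>

lemma independent_chain:
  assumes "a \<noteq> 0" "b \<notin> vec.span {a}" "c \<notin> vec.span {b, a}" "d \<notin> vec.span {c, b, a}"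
  shows "vec.independent {a, b, c, d}" "card {a, b, c, d} = 4"
proof -
  have "vec.independent {d, c, b, a}"
    using assms by (intro vec.independent_insertI) (auto simp: vec.independent_empty)
  then show "vec.independent {a, b, c, d}" by (simp add: insert_commute)
  have "b \<noteq> a" "c \<notin> {b, a}" "d \<notin> {c, b, a}"
    using assms(2-4) by (metis vec.span_base insertI1, metis vec.span_base, metis vec.span_base)
  then show "card {a, b, c, d} = 4" by auto
qed

lemma ex_not_in_span:
  assumes "finite B" "card B < CARD('n)"
  shows "\<exists>v :: 'k::field^'n. v \<notin> vec.span B"
proof (rule ccontr)
  assume "\<not> ?thesis"
  then have "UNIV \<subseteq> vec.span B" by blast
  then have "vec.dim (UNIV :: ('k^'n) set) \<le> card B"
    using assms vec.dim_le_card by blast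
  then show False using assms by (simp add: card_cart_basis)
qed

lemma cols4_coords:
  assumes "invertible (cols4 a b c d)"
  shows "\<exists>s t u w. v = s *s a + t *s b + u *s c + w *s d"
proof -
  obtain B where "cols4 a b c d ** B = mat 1" using assms unfolding invertible_def by blast
  then have "cols4 a b c d *v (B *v v) = v"
    by (simp add: matrix_vector_mul_assoc)
  then show ?thesis unfolding cols4_mult_vec by metis
qed

lemma cols4_coords_zero:
  assumes "invertible (cols4 a b c d)" "s *s a + t *s b + u *s c + w *s d = 0"
  shows "s = 0" "t = 0" "u = 0" "w = 0"
proof -
  have "cols4 a b c d *v (vector [s, t, u, w]) = 0"
    using assms(2) by (simp add: cols4_mult_vec)
  then have "(vector [s, t, u, w] :: _^4) = 0"
    using assms(1) matrix_left_invertible_ker unfolding invertible_def by blast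
  then show "s = 0" "t = 0" "u = 0" "w = 0"
    by (simp_all add: vec_eq_iff forall_4)
qed

lemma matrix_inv_inverse:
  fixes P :: "'k::field^'n^'n"
  assumes "invertible P"
  shows "P ** matrix_inv P = mat 1" "matrix_inv P ** P = mat 1"
proof -
  have "P ** matrix_inv P = mat 1 \<and> matrix_inv P ** P = mat 1"
    using assms unfolding invertible_def matrix_inv_def by (rule someI_ex)
  then show "P ** matrix_inv P = mat 1" "matrix_inv P ** P = mat 1"
    by simp_all
qed

lemma mult_conj_matrix_inv:
  fixes A P M :: "'k::field^'n^'n"
  assumes "invertible P" "A ** P = P ** M"
  shows "matrix_inv P ** A ** P = M"
  by (metis assms matrix_inv_inverse(2) matrix_mul_assoc matrix_mul_lid)

text \<open>Used in contrapositive form: a vector that \<open>A\<close> does not kill is outside the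
  span of vectors that it kills. This gives the independence of Jordan chains.\<close>

lemma mult_vec_eq_0_on_span:
  fixes A :: "'k::field^'n^'m"
  assumes "\<forall>v\<in>B. A *v v = 0" "v \<in> vec.span B" shows "A *v v = 0"
  using assms(2)
  by (induction rule: vec.span_induct_alt)
    (auto simp: assms(1) matrix_vector_right_distrib vector_scalar_commute)

section \<open>Nilpotency from order p in characteristic p\<close>

lemma funpow_mat_add_one:
  fixes N :: "'k::field^'n^'n"
  shows "((\<lambda>v. v + N *v v) ^^ n) v = (\<Sum>k\<le>n. of_nat (n choose k) *s (((*v) N) ^^ k) v)"
proof (induction n)
  case (Suc n)
  let ?f = "\<lambda>k. (((*v) N) ^^ k) v"
  have "((\<lambda>v. v + N *v v) ^^ Suc n) v = (\<Sum>k\<le>n. of_nat (n choose k) *s ?f k)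
     + (\<Sum>k\<le>n. of_nat (n choose k) *s ?f (Suc k))"
    by (simp add: Suc matrix_vector_mul_linear_gen vec.linear_sum vector_scalar_commute)
  \<comment> \<open>The added term k = n + 1 is zero; splitting off k = 0 then leaves the index
    range of the other sum, and Pascal's rule combines the two.\<close>
  also have "(\<Sum>k\<le>n. of_nat (n choose k) *s ?f k) = (\<Sum>k\<le>Suc n. of_nat (n choose k) *s ?f k)"
    by (simp add: binomial_eq_0)
  also have "\<dots> = v + (\<Sum>k\<le>n. of_nat (n choose Suc k) *s ?f (Suc k))"
    by (subst sum.atMost_Suc_shift) simp
  finally have "((\<lambda>v. v + N *v v) ^^ Suc n) v = v + (\<Sum>k\<le>n. of_nat (Suc n choose Suc k) *s ?f (Suc k))"
    by (simp add: sum.distrib[symmetric] vector_sadd_rdistrib ac_simps del: funpow.simps)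
  also have "\<dots> = (\<Sum>k\<le>Suc n. of_nat (Suc n choose k) *s ?f k)"
    by (subst sum.atMost_Suc_shift) simp
  finally show ?case .
qed simp

text \<open>Expand A = 1 + (A - 1): the binomial coefficients strictly between the ends vanish in
  characteristic p, so the p-th iterates satisfy A^p = 1 + (A - 1)^p.\<close>

lemma funpow_diff_one_eq_0:
  fixes A :: "'k::field^'n^'n"
  assumes "prime CHAR('k)" "((*v) A ^^ CHAR('k)) v = v"
  shows "((*v) (A - mat 1) ^^ CHAR('k)) v = 0"
proof -
  let ?p = "CHAR('k)" and ?M = "A - mat 1"
  let ?f = "\<lambda>k. of_nat (?p choose k) *s (((*v) ?M) ^^ k) v"
  have p: "?p > 0" using assms(1) prime_gt_0_nat by blast
  have "(\<lambda>v. v + ?M *v v) = (*v) A"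
    by (simp add: matrix_vector_mult_diff_rdistrib fun_eq_iff)
  then have "v = (\<Sum>k\<le>?p. ?f k)"
    using funpow_mat_add_one[where N = ?M and n = ?p and v = v] assms(2) by simp
  also have "\<dots> = (\<Sum>k\<in>{0, ?p}. ?f k)"
  proof (rule sum.mono_neutral_right)
    show "\<forall>i\<in>{..?p} - {0, ?p}. ?f i = 0"
      using dvd_choose_prime[of _ ?p] assms(1)
      by (auto simp: of_nat_eq_0_iff_char_dvd)
  qed auto
  also have "\<dots> = v + (((*v) ?M) ^^ ?p) v"
    using p by simp
  finally show ?thesis by simp
qed

lemma nilpotent_eigenvalue:
  fixes N :: "'k::field^'n^'n"
  assumes "((*v) N ^^ n) v = 0" "N *v v = a *s v" "v \<noteq> 0"
  shows "a = 0"
proof -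
  have "((*v) N ^^ m) v = a ^ m *s v" for m
    by (induction m) (auto simp: assms(2) vector_scalar_commute vector_smult_assoc mult.commute)
  then show ?thesis using assms by simp
qed

section \<open>Normal forms and commuting nilpotent families\<close>

abbreviation (input) form1 :: "'k \<Rightarrow> 'k \<Rightarrow> 'k \<Rightarrow> 'k::field^4^4" where
  "form1 a b c \<equiv>
     vector [vector [1, a, b, c],
       vector [0, 1, a, b],
       vector [0, 0, 1, a],
       vector [0, 0, 0, 1]]"

abbreviation (input) form2 :: "'k \<Rightarrow> 'k \<Rightarrow> 'k \<Rightarrow> 'k::field^4^4" where
  "form2 a b c \<equiv>
     vector [vector [1, a, b, c],
       vector [0, 1, a, 0],
       vector [0, 0, 1, 0],
       vector [0, 0, 0, 1]]"

abbreviation (input) form3 :: "'k \<Rightarrow> 'k \<Rightarrow> 'k \<Rightarrow> 'k::field^4^4" where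
  "form3 a b c \<equiv>
     vector [vector [1, 0, 0, c],
       vector [0, 1, a, b],
       vector [0, 0, 1, a],
       vector [0, 0, 0, 1]]"

abbreviation (input) form4 :: "'k \<Rightarrow> 'k \<Rightarrow> 'k \<Rightarrow> 'k::field^4^4" where
  "form4 a b c \<equiv>
     vector [vector [1, a, b, c],
       vector [0, 1, 0, 0],
       vector [0, 0, 1, 0],
       vector [0, 0, 0, 1]]"

abbreviation (input) form5 :: "'k \<Rightarrow> 'k \<Rightarrow> 'k \<Rightarrow> 'k \<Rightarrow> 'k::field^4^4" where
  "form5 a b c d \<equiv>
     vector [vector [1, 0, a, b],
       vector [0, 1, c, d],
       vector [0, 0, 1, 0],
       vector [0, 0, 0, 1]]"

abbreviation (input) form6 :: "'k \<Rightarrow> 'k \<Rightarrow> 'k \<Rightarrow> 'k::field^4^4" where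
  "form6 a b c \<equiv>
     vector [vector [1, 0, 0, a],
       vector [0, 1, 0, b],
       vector [0, 0, 1, c],
       vector [0, 0, 0, 1]]"

text \<open>The constants are the entries of a symmetric 2 x 2 matrix, which applied to (a, b) gives
  the two middle entries of the last column. Symmetry makes any two such matrices with the same
  constants commute; the condition imposed later on \<open>l\<close>, \<open>m\<close>,
  \<open>n\<close> is nondegeneracy.\<close>

abbreviation (input) form7 :: "'k \<Rightarrow> 'k \<Rightarrow> 'k \<Rightarrow> 'k \<Rightarrow> 'k \<Rightarrow> 'k \<Rightarrow> 'k::field^4^4" where
  "form7 l m n a b c \<equiv>
     vector [vector [1, a, b, c],
       vector [0, 1, 0, l * a + m * b],
       vector [0, 0, 1, m * a + n * b],
       vector [0, 0, 0, 1]]"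

lemmas mat_vec_linear = matrix_vector_right_distrib vector_scalar_commute
  matrix_vector_mult_add_rdistrib

text \<open>Take the least m at which the orbit of \<open>v\<close> reaches 0 and start m - (j + 1)
  steps along it: after j further steps one stands at the last nonzero vector.\<close>

lemma funpow_chain_end:
  assumes "(f ^^ j) v \<noteq> 0" "(f ^^ n) v = (0 :: 'a::zero)" "f 0 = 0"
  obtains w where "(f ^^ j) w \<noteq> 0" "f ((f ^^ j) w) = 0"
proof -
  define m where "m = (LEAST m. (f ^^ m) v = 0)"
  have m0: "(f ^^ m) v = 0"
    unfolding m_def using assms(2) by (rule LeastI)
  have zero: "(f ^^ i) 0 = 0" for i
    by (induction i) (auto simp: assms(3))
  have "m > j"
  proof (rule ccontr)
    assume "\<not> m > j"
    then have "(f ^^ j) v = (f ^^ (j - m)) ((f ^^ m) v)"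
      by (metis funpow_add comp_apply le_add_diff_inverse2 not_le)
    then show False using assms(1) m0 zero by simp
  qed
  moreover have "(f ^^ (m - 1)) v \<noteq> 0"
    unfolding m_def by (rule not_less_Least) (use \<open>m > j\<close> m_def in auto)
  ultimately show thesis
  proof (intro that[of "(f ^^ (m - Suc j)) v"])
    have e: "(f ^^ j) ((f ^^ (m - Suc j)) v) = (f ^^ (m - 1)) v"
      using \<open>m > j\<close> by (simp flip: funpow_add comp_apply[of "f ^^ j"])
    show "(f ^^ j) ((f ^^ (m - Suc j)) v) \<noteq> 0"
      using e \<open>(f ^^ (m - 1)) v \<noteq> 0\<close> by simp
    have "f ((f ^^ (m - 1)) v) = (f ^^ m) v"
      using \<open>m > j\<close> by (metis Suc_diff_1 funpow.simps(2) comp_apply gr_implies_not0 gr0I)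
    then show "f ((f ^^ j) ((f ^^ (m - Suc j)) v)) = 0"
      using e m0 by simp
  qed
qed

text \<open>The matrices 1 + X play the role of group elements: since (1 + X)(1 + Y) = 1 + (X + Y +
  XY), the condition \<open>closed\<close> is closure under multiplication. The exponent
  \<open>n\<close> will be p.\<close>

locale commuting_nilpotent =
  fixes S :: "('k::field^4^4) set" and n :: nat
  assumes commute: "X \<in> S \<Longrightarrow> Y \<in> S \<Longrightarrow> X ** Y = Y ** X"
    and nilpotent: "X \<in> S \<Longrightarrow> ((*v) X ^^ n) v = 0"
    and closed: "X \<in> S \<Longrightarrow> Y \<in> S \<Longrightarrow> X + Y + X ** Y \<in> S"
    and two_neq_zero: "(2::'k) \<noteq> 0"
begin

lemma commute_vec: "X \<in> S \<Longrightarrow> Y \<in> S \<Longrightarrow> X *v (Y *v v) = Y *v (X *v v)"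
  by (simp add: matrix_vector_mul_assoc commute)

lemma eigenvalue_0: "X \<in> S \<Longrightarrow> X *v v = a *s v \<Longrightarrow> v \<noteq> 0 \<Longrightarrow> a = 0"
  using nilpotent nilpotent_eigenvalue by blast

section \<open>A nonzero cube: one Jordan block\<close>

lemma cube_nonzero:
  assumes X: "X \<in> S" and v: "X *v (X *v (X *v v)) \<noteq> 0"
  shows "\<exists>P. invertible P \<and> (\<forall>Y\<in>S. \<exists>a b c. (mat 1 + Y) ** P = P ** form1 a b c)"
proof -
  \<comment> \<open>Nilpotency is known only with exponent \<open>n\<close>, so the fourth iterate
    at \<open>v\<close> is not yet known to vanish. Moving along the orbit yields a chain of length
    exactly 4.\<close>
  obtain w where "((*v) X ^^ 3) w \<noteq> 0" "X *v (((*v) X ^^ 3) w) = 0"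
    by (rule funpow_chain_end[of 3 "(*v) X" v n]) (use v nilpotent[OF X] in \<open>auto simp: eval_nat_numeral\<close>)
  then have a: "X *v (X *v (X *v w)) \<noteq> 0" and Xa: "X *v (X *v (X *v (X *v w))) = 0"
    by (simp_all add: eval_nat_numeral)
  define a b c where abc: "a = X *v (X *v (X *v w))" "b = X *v (X *v w)" "c = X *v w"
  have X_simps: "X *v w = c" "X *v c = b" "X *v b = a" "X *v a = 0"
    using Xa by (simp_all add: abc)
  have a0: "a \<noteq> 0" using a abc by simp
  \<comment> \<open>A suitable power of \<open>X\<close> kills the earlier vectors of the chain and
    sends the next one to \<open>a\<close>.\<close>
  have "b \<notin> vec.span {a}"
    using mult_vec_eq_0_on_span[of "{a}" X b] a0 by (auto simp: X_simps)
  moreover have "c \<notin> vec.span {b, a}"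
    using mult_vec_eq_0_on_span[of "{b, a}" "X ** X" c] a0
    by (auto simp: X_simps simp flip: matrix_vector_mul_assoc)
  moreover have "w \<notin> vec.span {c, b, a}"
    using mult_vec_eq_0_on_span[of "{c, b, a}" "X ** (X ** X)" w] a0
    by (auto simp: X_simps simp flip: matrix_vector_mul_assoc)
  ultimately have inv: "invertible (cols4 a b c w)"
    using a0 by (intro invertible_cols4 independent_chain)
  have "\<exists>\<alpha> \<beta> \<gamma>. (mat 1 + Y) ** cols4 a b c w = cols4 a b c w ** form1 \<alpha> \<beta> \<gamma>" if Y: "Y \<in> S" for Y
  proof -
    obtain s t u q where Yw: "Y *v w = s *s a + t *s b + u *s c + q *s w"
      using cols4_coords[OF inv] by blast
    \<comment> \<open>Since \<open>Y\<close> commutes with \<open>X\<close>, its value at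
      \<open>w\<close> determines it: Y = s X^3 + t X^2 + u X + q. On \<open>a\<close> only the
      eigenvalue \<open>q\<close> survives, and it is 0 by nilpotency.\<close>
    have Yc: "Y *v c = X *v (Y *v w)" and Yb: "Y *v b = X *v (Y *v c)"
      and Ya: "Y *v a = X *v (Y *v b)"
      using commute_vec[OF X Y] by (simp_all add: X_simps)
    have "Y *v a = q *s a"
      by (simp add: Ya Yb Yc Yw mat_vec_linear X_simps)
    then have "q = 0"
      using eigenvalue_0[OF Y] a0 by blast
    then have "Y *v w = s *s a + t *s b + u *s c" "Y *v c = t *s a + u *s b"
      "Y *v b = u *s a" "Y *v a = 0"
      by (simp_all add: Ya Yb Yc Yw mat_vec_linear X_simps)
    then have "(mat 1 + Y) ** cols4 a b c w = cols4 a b c w ** form1 u t s"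
      by (simp add: mult_cols4 cols4_mult mat_vec_linear add.commute add.left_commute)
    then show ?thesis by blast
  qed
  then show ?thesis using inv by blast
qed

section \<open>A nonzero square with zero cube: Jordan type (3, 1)\<close>

lemma square_nonzero_basis:
  assumes X: "X \<in> S" and v: "X *v (X *v v) \<noteq> 0" and cube: "\<And>v. X *v (X *v (X *v v)) = 0"
  obtains a b u where "X *v v = b" "X *v b = a" "X *v a = 0" "X *v u = 0" "a \<noteq> 0"
    "vec.independent {a, b, v, u}" "card {a, b, v, u} = 4"
proof -
  define a b where ab: "a = X *v (X *v v)" "b = X *v v"
  have X_simps: "X *v v = b" "X *v b = a" "X *v a = 0"
    using cube by (simp_all add: ab)
  have a0: "a \<noteq> 0" using v ab by simp
  have b: "b \<notin> vec.span {a}"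
    using mult_vec_eq_0_on_span[of "{a}" X b] a0 by (auto simp: X_simps)
  have v': "v \<notin> vec.span {b, a}"
    using mult_vec_eq_0_on_span[of "{b, a}" "X ** X" v] a0
    by (auto simp: X_simps simp flip: matrix_vector_mul_assoc)
  have "\<exists>w. w \<notin> vec.span {v, b, a}"
    by (rule ex_not_in_span) (auto simp: card_insert_if)
  then obtain w where w: "w \<notin> vec.span {v, b, a}" by blast
  have inv: "invertible (cols4 a b v w)"
    using a0 b v' w by (intro invertible_cols4 independent_chain)
  obtain s t q d where Xw: "X *v w = s *s a + t *s b + q *s v + d *s w"
    using cols4_coords[OF inv] by blast
  \<comment> \<open>In the vanishing cube the coordinate at \<open>w\<close> gives d = 0; then the
    coordinate at \<open>a\<close> gives q = 0.\<close>
  have "X *v (X *v (X *v w)) = (q + d * t + d * d * s) *s a + (d * q + d * d * t) *s b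
      + (d * d * q) *s v + (d * d * d) *s w"
    by (simp add: Xw mat_vec_linear X_simps)
  then have 0: "q + d * t + d * d * s = 0" "d * d * d = 0"
    using cols4_coords_zero[OF inv] cube by metis+
  then have d: "d = 0" and q: "q = 0" by simp_all
  \<comment> \<open>Now X w = s a + t b is also the image of t v + s b, so the difference lies in
    the kernel of \<open>X\<close> and still completes the basis.\<close>
  define u where "u = w - (t *s v + s *s b)"
  have "X *v u = 0"
    by (simp add: u_def Xw d q mat_vec_linear matrix_vector_mult_diff_distrib X_simps)
  moreover have "u \<notin> vec.span {v, b, a}"
  proof
    assume "u \<in> vec.span {v, b, a}"
    moreover have "t *s v + s *s b \<in> vec.span {v, b, a}"
      by (intro vec.span_add vec.span_scale vec.span_base) auto
    ultimately have "u + (t *s v + s *s b) \<in> vec.span {v, b, a}"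
      by (rule vec.span_add)
    then show False using w by (simp add: u_def)
  qed
  ultimately show thesis
    using that[of b a u] X_simps a0 independent_chain[OF a0 b v'] by blast
qed

text \<open>Commuting with the element \<open>X\<close> of Jordan type (3, 1) leaves the four parameters
  \<open>t, s, d, e\<close> below, and commutativity of the family makes the pairs \<open>(d, e)\<close> pairwise
  proportional. The line through them decides between the three forms.\<close>
lemma square_nonzero:
  assumes X: "X \<in> S" and v: "X *v (X *v v) \<noteq> 0" and cube: "\<And>v. X *v (X *v (X *v v)) = 0"
  shows "\<exists>P. invertible P \<and>
    ((\<forall>Y\<in>S. \<exists>a b c. (mat 1 + Y) ** P = P ** form2 a b c) \<or>
     (\<forall>Y\<in>S. \<exists>a b c. (mat 1 + Y) ** P = P ** form3 a b c) \<or>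
     (\<exists>l m n. l * n - m\<^sup>2 \<noteq> 0 \<and>
       (\<forall>Y\<in>S. \<exists>a b c. (mat 1 + Y) ** P = P ** form7 l m n a b c)))"
proof -
  obtain a b u where X_simps: "X *v v = b" "X *v b = a" "X *v a = 0" "X *v u = 0" and a0: "a \<noteq> 0"
    and basis: "vec.independent {a, b, v, u}" "card {a, b, v, u} = 4"
    using square_nonzero_basis[OF assms] by metis
  \<comment> \<open>Three orderings of one basis, for forms (2), (3) and (7) respectively.\<close>
  have inv: "invertible (cols4 a b v u)" "invertible (cols4 u a b v)" "invertible (cols4 a b u v)"
    using basis by (auto intro!: invertible_cols4 simp: insert_commute)
  have "\<exists>t s d e. Y *v v = s *s a + t *s b + d *s u \<and> Y *v b = t *s a \<and> Y *v a = 0 \<and> Y *v u = e *s a"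
    if Y: "Y \<in> S" for Y
  proof -
    obtain s t q d where Yv: "Y *v v = s *s a + t *s b + q *s v + d *s u"
      using cols4_coords[OF inv(1)] by blast
    have Yb: "Y *v b = X *v (Y *v v)" and Ya: "Y *v a = X *v (Y *v b)"
      using commute_vec[OF X Y] by (simp_all add: X_simps)
    have "Y *v a = q *s a"
      by (simp add: Ya Yb Yv mat_vec_linear X_simps)
    then have q: "q = 0"
      using eigenvalue_0[OF Y] a0 by blast
    have Ya0: "Y *v a = 0" using \<open>Y *v a = q *s a\<close> q by simp
    obtain e c2 c3 f where Yu: "Y *v u = e *s a + c2 *s b + c3 *s v + f *s u"
      using cols4_coords[OF inv(1)] by blast
    \<comment> \<open>X (Y u) = Y (X u) = 0, while \<open>X\<close> sends the \<open>b\<close> and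
      \<open>v\<close> parts of Y u to the independent vectors \<open>a\<close> and
      \<open>b\<close>.\<close>
    have "c2 *s a + c3 *s b + 0 *s v + 0 *s u = X *v (Y *v u)"
      by (simp add: Yu mat_vec_linear X_simps)
    also have "\<dots> = 0"
      using commute_vec[OF X Y, of u] by (simp add: X_simps)
    finally have c: "c2 = 0" "c3 = 0"
      using cols4_coords_zero[OF inv(1)] by blast+
    \<comment> \<open>With Y a = 0 and Y u = e a + f u, the vector Y u is an eigenvector for
      \<open>f\<close> unless it is zero.\<close>
    have "f = 0"
    proof (cases "Y *v u = 0")
      case True
      then show ?thesis using cols4_coords_zero(4)[OF inv(1), of e c2 c3 f] Yu by simp
    next
      case False
      have "Y *v (Y *v u) = f *s (Y *v u)"
        by (subst (1) Yu) (simp add: c mat_vec_linear Ya0)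
      then show ?thesis using eigenvalue_0[OF Y] False by blast
    qed
    then have "Y *v u = e *s a" using Yu c by simp
    moreover have "Y *v b = t *s a" by (simp add: Yb Yv mat_vec_linear X_simps q)
    ultimately show ?thesis using Yv q Ya0 by auto
  qed
  then obtain T s d e where YY: "\<And>Y. Y \<in> S \<Longrightarrow> Y *v v = s Y *s a + T Y *s b + d Y *s u"
     "\<And>Y. Y \<in> S \<Longrightarrow> Y *v b = T Y *s a" "\<And>Y. Y \<in> S \<Longrightarrow> Y *v a = 0" "\<And>Y. Y \<in> S \<Longrightarrow> Y *v u = e Y *s a"
    by metis
  have parallel: "d Y * e Z = d Z * e Y" if "Y \<in> S" "Z \<in> S" for Y Z
  proof -
    have "(T Z * T Y + d Z * e Y) *s a = Y *v (Z *v v)"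
      using that by (simp add: YY mat_vec_linear vector_smult_assoc vector_sadd_rdistrib)
    also have "\<dots> = Z *v (Y *v v)"
      using commute_vec that by blast
    also have "\<dots> = (T Z * T Y + d Y * e Z) *s a"
      using that by (simp add: YY mat_vec_linear vector_smult_assoc vector_sadd_rdistrib mult.commute)
    finally show ?thesis using a0 by (simp add: vec.scale_cancel_right)
  qed
  consider (d0) "\<forall>Y\<in>S. d Y = 0" | (e0) "\<forall>Y\<in>S. e Y = 0"
    | (neither) Y1 Y2 where "Y1 \<in> S" "Y2 \<in> S" "d Y1 \<noteq> 0" "e Y2 \<noteq> 0" by blast
  then show ?thesis
  proof cases
    case d0
    have "(mat 1 + Y) ** cols4 a b v u = cols4 a b v u ** form2 (T Y) (s Y) (e Y)" if "Y \<in> S" for Y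
      using that d0 by (simp add: mult_cols4 cols4_mult mat_vec_linear YY add.commute add.left_commute)
    then show ?thesis using inv(1) by blast
  next
    case e0
    have "(mat 1 + Y) ** cols4 u a b v = cols4 u a b v ** form3 (T Y) (s Y) (d Y)" if "Y \<in> S" for Y
      using that e0 by (simp add: mult_cols4 cols4_mult mat_vec_linear YY add.commute add.left_commute)
    then show ?thesis using inv(2) by blast
  next
    case neither
    \<comment> \<open>By proportionality d(Y1) e(Y2) = d(Y2) e(Y1), and the left side is nonzero. So
      the ratio \<open>r\<close> of d to e is finite, nonzero and common to the family, which gives
      the constants 1, 0, \<open>r\<close> of form (7).\<close>
    then have e1: "e Y1 \<noteq> 0" using parallel[of Y1 Y2] by auto
    define r where "r = d Y1 / e Y1"
    have d: "d Y = r * e Y" if "Y \<in> S" for Y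
      using parallel[of Y Y1] that neither(1) e1 by (simp add: r_def field_simps)
    have "(mat 1 + Y) ** cols4 a b u v = cols4 a b u v ** form7 1 0 r (T Y) (e Y) (s Y)" if "Y \<in> S" for Y
      using that by (simp add: mult_cols4 cols4_mult mat_vec_linear YY d add.commute add.left_commute)
    moreover have "1 * r - 0\<^sup>2 \<noteq> 0" using neither e1 by (simp add: r_def)
    ultimately show ?thesis using inv(3) by blast
  qed
qed

section \<open>All squares zero: the common kernel\<close>

text \<open>Polarization: the square of the member \<open>X + Y + X ** Y\<close> is \<open>2 X ** Y\<close>.\<close>
lemma mult_eq_0_if_squares_eq_0:
  assumes sq: "\<And>X v. X \<in> S \<Longrightarrow> X *v (X *v v) = 0" and S: "X \<in> S" "Y \<in> S"
  shows "X *v (Y *v v) = 0"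
proof -
  let ?Z = "X + Y + X ** Y"
  have YX: "Y *v (X *v w) = X *v (Y *v w)" for w using commute_vec S by blast
  have Z: "?Z *v w = X *v w + Y *v w + X *v (Y *v w)" for w
    by (simp add: mat_vec_linear matrix_vector_mul_assoc)
  have "0 = ?Z *v (?Z *v v)" using sq closed S by simp
  also have "\<dots> = X *v (Y *v v) + X *v (Y *v v)"
    unfolding Z by (simp add: mat_vec_linear YX sq S)
  also have "\<dots> = 2 *s (X *v (Y *v v))"
    by (simp add: vec_eq_iff)
  finally show ?thesis using two_neq_zero by (simp add: vec_eq_iff)
qed

lemma squares_eq_0:
  assumes "\<forall>X\<in>S. \<forall>v. X *v (X *v v) = 0"
  shows "\<exists>P. invertible P \<and>
    ((\<forall>Y\<in>S. \<exists>a b c. (mat 1 + Y) ** P = P ** form4 a b c) \<or>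
     (\<forall>Y\<in>S. \<exists>a b c d. (mat 1 + Y) ** P = P ** form5 a b c d) \<or>
     (\<forall>Y\<in>S. \<exists>a b c. (mat 1 + Y) ** P = P ** form6 a b c))"
proof -
  note sq = assms[rule_format]
  define K where "K = {v. \<forall>Y\<in>S. Y *v v = 0}"
  have img: "Y *v v \<in> K" if "Y \<in> S" for Y v
    using mult_eq_0_if_squares_eq_0 sq that by (simp add: K_def)
  have ker: "Y *v v = 0" if "Y \<in> S" "v \<in> K" for Y v
    using that by (simp add: K_def)
  \<comment> \<open>Either some image is nonzero, and images lie in \<open>K\<close>, or every
    member acts as zero and \<open>K\<close> is the whole space.\<close>
  have "\<exists>a\<in>K. a \<noteq> 0"
  proof (cases "\<exists>Y\<in>S. \<exists>v. Y *v v \<noteq> 0")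
    case True
    then show ?thesis using img by blast
  next
    case False
    then have "axis 1 1 \<in> K" by (simp add: K_def)
    moreover have "axis 1 (1::'k) \<noteq> (0::'k^4)" by (simp add: axis_eq_0_iff)
    ultimately show ?thesis by blast
  qed
  then obtain a where a: "a \<in> K" "a \<noteq> 0" by blast
  have ex1: "\<exists>v::'k^4. v \<notin> vec.span {x}" for x
    by (rule ex_not_in_span) auto
  have ex2: "\<exists>v::'k^4. v \<notin> vec.span {x, y}" for x y
    by (rule ex_not_in_span) (auto simp: card_insert_if)
  have ex3: "\<exists>v::'k^4. v \<notin> vec.span {x, y, z}" for x y z
    by (rule ex_not_in_span) (auto simp: card_insert_if)
  show ?thesis
  proof (cases "K \<subseteq> vec.span {a}")
    case True
    obtain b where b: "b \<notin> vec.span {a}" using ex1 by blast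
    obtain c where c: "c \<notin> vec.span {b, a}" using ex2 by blast
    obtain d where d: "d \<notin> vec.span {c, b, a}" using ex3 by blast
    have "\<exists>s t u. (mat 1 + Y) ** cols4 a b c d = cols4 a b c d ** form4 s t u" if Y: "Y \<in> S" for Y
    proof -
      have "\<exists>k. Y *v v = k *s a" for v
        using True img[OF Y, of v] by (auto simp: vec.span_singleton)
      then obtain s t u where "Y *v b = s *s a" "Y *v c = t *s a" "Y *v d = u *s a" by metis
      then have "(mat 1 + Y) ** cols4 a b c d = cols4 a b c d ** form4 s t u"
        by (simp add: mult_cols4 cols4_mult mat_vec_linear ker[OF Y a(1)] add.commute)
      then show ?thesis by blast
    qed
    then show ?thesis
      using invertible_cols4[OF independent_chain[OF a(2) b c d]] by blast
  next
    case False
    then obtain b where b: "b \<in> K" "b \<notin> vec.span {a}" by blast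
    show ?thesis
    proof (cases "K \<subseteq> vec.span {b, a}")
      case True
      obtain c where c: "c \<notin> vec.span {b, a}" using ex2 by blast
      obtain d where d: "d \<notin> vec.span {c, b, a}" using ex3 by blast
      have "\<exists>s t u w. (mat 1 + Y) ** cols4 a b c d = cols4 a b c d ** form5 s t u w" if Y: "Y \<in> S" for Y
      proof -
        have "\<exists>k j. Y *v v = k *s a + j *s b" for v
        proof -
          obtain k where "Y *v v - k *s b \<in> vec.span {a}"
            using True img[OF Y, of v] vec.span_breakdown_eq by blast
          then obtain j where "Y *v v - k *s b = j *s a" by (auto simp: vec.span_singleton)
          then show ?thesis by (metis diff_eq_eq)
        qed
        then obtain s t u w where "Y *v c = s *s a + u *s b" "Y *v d = t *s a + w *s b" by metis
        then have "(mat 1 + Y) ** cols4 a b c d = cols4 a b c d ** form5 s t u w"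
          by (simp add: mult_cols4 cols4_mult mat_vec_linear ker[OF Y a(1)] ker[OF Y b(1)]
             add.commute add.left_commute)
        then show ?thesis by blast
      qed
      then show ?thesis
        using invertible_cols4[OF independent_chain[OF a(2) b(2) c d]] by blast
    next
      case False
      \<comment> \<open>Here \<open>K\<close> has dimension at least 3; the case that it is the
        whole space is included.\<close>
      then obtain c where c: "c \<in> K" "c \<notin> vec.span {b, a}" by blast
      obtain d where d: "d \<notin> vec.span {c, b, a}" using ex3 by blast
      have inv: "invertible (cols4 a b c d)"
        by (rule invertible_cols4[OF independent_chain[OF a(2) b(2) c(2) d]])
      have "\<exists>s t u. (mat 1 + Y) ** cols4 a b c d = cols4 a b c d ** form6 s t u" if Y: "Y \<in> S" for Y
      proof -
        obtain s t u w where Yd: "Y *v d = s *s a + t *s b + u *s c + w *s d"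
          using cols4_coords[OF inv] by blast
        \<comment> \<open>\<open>Y\<close> kills \<open>a\<close>, \<open>b\<close> and
          \<open>c\<close>, so a second application leaves only the factor \<open>w\<close>. As
          squares vanish, w = 0 or Y d = 0, and the latter also forces w = 0.\<close>
        have "Y *v (Y *v d) = w *s (Y *v d)"
          by (subst (1) Yd) (simp add: mat_vec_linear ker[OF Y a(1)] ker[OF Y b(1)] ker[OF Y c(1)])
        then have "w = 0 \<or> Y *v d = 0" using sq[OF Y, of d] by simp
        then have "w = 0" using cols4_coords_zero(4)[OF inv, of s t u w] Yd by auto
        then have "(mat 1 + Y) ** cols4 a b c d = cols4 a b c d ** form6 s t u"
          by (simp add: mult_cols4 cols4_mult mat_vec_linear ker[OF Y a(1)] ker[OF Y b(1)]
              ker[OF Y c(1)] Yd add.commute)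
        then show ?thesis by blast
      qed
      then show ?thesis using inv by blast
    qed
  qed
qed

theorem simultaneous_form:
  "\<exists>P. invertible P \<and>
    ((\<forall>Y\<in>S. \<exists>a b c. (mat 1 + Y) ** P = P ** form1 a b c) \<or>
     (\<forall>Y\<in>S. \<exists>a b c. (mat 1 + Y) ** P = P ** form2 a b c) \<or>
     (\<forall>Y\<in>S. \<exists>a b c. (mat 1 + Y) ** P = P ** form3 a b c) \<or>
     (\<forall>Y\<in>S. \<exists>a b c. (mat 1 + Y) ** P = P ** form4 a b c) \<or>
     (\<forall>Y\<in>S. \<exists>a b c d. (mat 1 + Y) ** P = P ** form5 a b c d) \<or>
     (\<forall>Y\<in>S. \<exists>a b c. (mat 1 + Y) ** P = P ** form6 a b c) \<or>
     (\<exists>l m n. l * n - m\<^sup>2 \<noteq> 0 \<and>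
       (\<forall>Y\<in>S. \<exists>a b c. (mat 1 + Y) ** P = P ** form7 l m n a b c)))"
proof -
  consider (cube) X v where "X \<in> S" "X *v (X *v (X *v v)) \<noteq> 0"
    | (square) X v where "X \<in> S" "X *v (X *v v) \<noteq> 0" "\<And>v. X *v (X *v (X *v v)) = 0"
    | (zero) "\<forall>X\<in>S. \<forall>v. X *v (X *v v) = 0"
    by blast
  then show ?thesis
  proof cases
    case cube
    then show ?thesis using cube_nonzero by meson
  next
    case square
    from square_nonzero[OF square] show ?thesis
      by (elim ex_forward conj_forward; (assumption | argo))
  next
    case zero
    from squares_eq_0[OF zero] show ?thesis
      by (elim ex_forward conj_forward; (assumption | argo))
  qed
qed

end

section \<open>Elementary abelian groups and their representations\<close>

lemma diff_one_mult:
  fixes A B :: "'k::field^'n^'n"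
  shows "(A - mat 1) + (B - mat 1) + (A - mat 1) ** (B - mat 1) = A ** B - mat 1"
proof -
  have "(mat 1 + X) ** (mat 1 + Y) = mat 1 + (X + Y + X ** Y)" for X Y :: "'k^'n^'n"
    by (subst matrix_eq, intro allI)
      (simp only: mat_vec_linear matrix_vector_mul_assoc[symmetric] matrix_vector_mul_lid add_ac)
  from this[of "A - mat 1" "B - mat 1"] show ?thesis
    by (simp only: add.commute[of "mat 1" "A - mat 1"] add.commute[of "mat 1" "B - mat 1"]
        diff_add_cancel add_diff_cancel_left')
qed

lemma elem_ab_commute: "g \<otimes>\<^bsub>elem_ab p r\<^esub> h = h \<otimes>\<^bsub>elem_ab p r\<^esub> g"
  by (auto simp: elem_ab_def add.commute intro!: restrict_ext)

text \<open>The group operation reduces every coordinate modulo p, so the formula holds for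
  arbitrary integer coordinates.\<close>

lemma elem_ab_pow:
  "g [^]\<^bsub>elem_ab p r\<^esub> m = (\<lambda>i\<in>{1..r}. (int m * g i) mod int p)"
  by (induction m)
    (auto simp: elem_ab_def nat_pow_def algebra_simps mod_simps intro!: restrict_ext)

lemma elem_ab_pow_p: "g [^]\<^bsub>elem_ab p r\<^esub> p = \<one>\<^bsub>elem_ab p r\<^esub>"
  unfolding elem_ab_pow by (auto simp: elem_ab_def intro!: restrict_ext)

lemma hom_GL_funpow:
  fixes \<rho> :: "'g \<Rightarrow> 'k::field ^ 'n ^ 'n"
  assumes "group G" "\<rho> \<in> hom G GL" "g \<in> carrier G"
  shows "((*v) (\<rho> g) ^^ m) v = \<rho> (g [^]\<^bsub>G\<^esub> m) *v v"
proof (induction m)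
  case 0
  have "\<rho> \<one>\<^bsub>G\<^esub> = \<one>\<^bsub>GL\<^esub>"
    using hom_one[OF assms(2,1) group_GL] .
  then show ?case by (simp add: GL_def)
next
  case (Suc m)
  interpret group G by fact
  have "\<rho> (g [^]\<^bsub>G\<^esub> Suc m) = \<rho> g ** \<rho> (g [^]\<^bsub>G\<^esub> m)"
    using assms(2,3) by (simp only: nat_pow_Suc2) (simp add: hom_def GL_def)
  then show ?case by (simp add: Suc matrix_vector_mul_assoc)
qed

lemma conj_hom_GL:
  fixes P :: "'k::field ^ 'n ^ 'n"
  assumes \<rho>: "\<rho> \<in> hom G GL" and P: "invertible P"
  shows "(\<lambda>g. matrix_inv P ** \<rho> g ** P) \<in> hom G GL"
proof -
  note inv = matrix_inv_inverse[OF P]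
  then have "invertible (matrix_inv P)"
    unfolding invertible_def by blast
  moreover have "matrix_inv P ** (A ** B) ** P = matrix_inv P ** A ** P ** (matrix_inv P ** B ** P)"
    for A B
    by (metis inv(1) matrix_mul_assoc matrix_mul_rid)
  ultimately show ?thesis
    using \<rho> P by (auto simp: hom_def GL_def Pi_iff invertible_mult)
qed

theorem theorem5p10:
  fixes p r :: nat
    and \<rho> :: "(nat \<Rightarrow> int) \<Rightarrow> 'k::field ^ 4 ^ 4"
  assumes "CHAR('k) = p" and "p \<ge> 5" and "r \<ge> 1"
    and "\<rho> \<in> hom (elem_ab p r) GL"
  shows "\<exists>\<rho>'. \<rho>' \<in> hom (elem_ab p r) GL \<and> equivalent_rep (elem_ab p r) \<rho> \<rho>' \<and>
    ((\<exists>\<alpha> \<beta> \<gamma> :: nat \<Rightarrow> 'k. \<forall>i\<in>{1..r}. \<rho>' (std_gen p r i) =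
        vector [vector [1, \<alpha> i, \<beta> i, \<gamma> i],
                vector [0, 1, \<alpha> i, \<beta> i],
                vector [0, 0, 1, \<alpha> i],
                vector [0, 0, 0, 1]]) \<or>
     (\<exists>\<alpha> \<beta> \<gamma> :: nat \<Rightarrow> 'k. \<forall>i\<in>{1..r}. \<rho>' (std_gen p r i) =
        vector [vector [1, \<alpha> i, \<beta> i, \<gamma> i],
                vector [0, 1, \<alpha> i, 0],
                vector [0, 0, 1, 0],
                vector [0, 0, 0, 1]]) \<or>
     (\<exists>\<alpha> \<beta> \<gamma> :: nat \<Rightarrow> 'k. \<forall>i\<in>{1..r}. \<rho>' (std_gen p r i) =
        vector [vector [1, 0, 0, \<gamma> i],
                vector [0, 1, \<alpha> i, \<beta> i],
                vector [0, 0, 1, \<alpha> i],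
                vector [0, 0, 0, 1]]) \<or>
     (\<exists>\<alpha> \<beta> \<gamma> :: nat \<Rightarrow> 'k. \<forall>i\<in>{1..r}. \<rho>' (std_gen p r i) =
        vector [vector [1, \<alpha> i, \<beta> i, \<gamma> i],
                vector [0, 1, 0, 0],
                vector [0, 0, 1, 0],
                vector [0, 0, 0, 1]]) \<or>
     (\<exists>\<alpha> \<beta> \<gamma> \<delta> :: nat \<Rightarrow> 'k. \<forall>i\<in>{1..r}. \<rho>' (std_gen p r i) =
        vector [vector [1, 0, \<alpha> i, \<beta> i],
                vector [0, 1, \<gamma> i, \<delta> i],
                vector [0, 0, 1, 0],
                vector [0, 0, 0, 1]]) \<or>
     (\<exists>\<alpha> \<beta> \<gamma> :: nat \<Rightarrow> 'k. \<forall>i\<in>{1..r}. \<rho>' (std_gen p r i) =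
        vector [vector [1, 0, 0, \<alpha> i],
                vector [0, 1, 0, \<beta> i],
                vector [0, 0, 1, \<gamma> i],
                vector [0, 0, 0, 1]]) \<or>
     (\<exists>l \<mu> \<nu> :: 'k. l * \<nu> - \<mu>\<^sup>2 \<noteq> 0 \<and>
       (\<exists>\<alpha> \<beta> \<gamma> :: nat \<Rightarrow> 'k. \<forall>i\<in>{1..r}. \<rho>' (std_gen p r i) =
        vector [vector [1, \<alpha> i, \<beta> i, \<gamma> i],
                vector [0, 1, 0, l * \<alpha> i + \<mu> * \<beta> i],
                vector [0, 0, 1, \<mu> * \<alpha> i + \<nu> * \<beta> i],
                vector [0, 0, 0, 1]])))"
proof -
  let ?G = "elem_ab p r"
  have "p > 0" using assms(2) by simp
  then have p: "prime CHAR('k)" using assms(1) prime_CHAR_semidom by blast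
  \<comment> \<open>The whole group is used rather than its generators, because polarization
    requires the family to be closed under products.\<close>
  define S where "S = (\<lambda>g. \<rho> g - mat 1) ` carrier ?G"
  have \<rho>_mult: "\<rho> g ** \<rho> h = \<rho> (g \<otimes>\<^bsub>?G\<^esub> h)" if "g \<in> carrier ?G" "h \<in> carrier ?G" for g h
    using assms(4) that by (simp add: hom_def GL_def)
  have "commuting_nilpotent S p"
  proof
    fix X Y assume "X \<in> S" "Y \<in> S"
    then obtain g h where g: "g \<in> carrier ?G" "X = \<rho> g - mat 1" and h: "h \<in> carrier ?G" "Y = \<rho> h - mat 1"
      by (auto simp: S_def)
    have "\<rho> g ** \<rho> h = \<rho> h ** \<rho> g"
      using g h by (simp add: \<rho>_mult elem_ab_commute[of _ _ g])
    \<comment> \<open>Both sides are the shifted product of the two group elements; cancelling X + Y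
      leaves commutation of \<open>X\<close> and \<open>Y\<close>.\<close>
    then have "X + Y + X ** Y = Y + X + Y ** X"
      unfolding g(2) h(2) diff_one_mult by simp
    then show "X ** Y = Y ** X"
      by (simp add: add.commute)
    show "X + Y + X ** Y \<in> S"
      unfolding g(2) h(2) diff_one_mult S_def
      using monoid.m_closed[OF group.is_monoid[OF group_elem_ab] g(1) h(1)] \<rho>_mult[OF g(1) h(1)]
      by (intro image_eqI) auto
  next
    fix X v assume "X \<in> S"
    then obtain g where g: "g \<in> carrier ?G" "X = \<rho> g - mat 1"
      by (auto simp: S_def)
    \<comment> \<open>The p-th and the 0-th power of \<open>g\<close> are both the group identity,
      so the two iterates agree.\<close>
    have "((*v) (\<rho> g) ^^ p) v = ((*v) (\<rho> g) ^^ 0) v"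
      unfolding hom_GL_funpow[OF group_elem_ab assms(4) g(1)] elem_ab_pow_p by simp
    then show "((*v) X ^^ p) v = 0"
      using funpow_diff_one_eq_0[OF p] assms(1) g(2) by simp
  next
    have "\<not> p dvd 2" using assms(2) by (auto dest: dvd_imp_le)
    then show "(2::'k) \<noteq> 0"
      using of_nat_eq_0_iff_char_dvd[of 2, where 'a = 'k] assms(1) by simp
  qed
  then obtain P where P: "invertible P" and forms:
    "(\<forall>Y\<in>S. \<exists>a b c. (mat 1 + Y) ** P = P ** form1 a b c) \<or>
     (\<forall>Y\<in>S. \<exists>a b c. (mat 1 + Y) ** P = P ** form2 a b c) \<or>
     (\<forall>Y\<in>S. \<exists>a b c. (mat 1 + Y) ** P = P ** form3 a b c) \<or>
     (\<forall>Y\<in>S. \<exists>a b c. (mat 1 + Y) ** P = P ** form4 a b c) \<or>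
     (\<forall>Y\<in>S. \<exists>a b c d. (mat 1 + Y) ** P = P ** form5 a b c d) \<or>
     (\<forall>Y\<in>S. \<exists>a b c. (mat 1 + Y) ** P = P ** form6 a b c) \<or>
     (\<exists>l m n. l * n - m\<^sup>2 \<noteq> 0 \<and>
       (\<forall>Y\<in>S. \<exists>a b c. (mat 1 + Y) ** P = P ** form7 l m n a b c))"
    by (elim commuting_nilpotent.simultaneous_form[THEN exE] conjE)
  define \<rho>' where "\<rho>' = (\<lambda>g. matrix_inv P ** \<rho> g ** P)"
  have hom: "\<rho>' \<in> hom ?G GL"
    unfolding \<rho>'_def by (rule conj_hom_GL[OF assms(4) P])
  have equiv: "equivalent_rep ?G \<rho> \<rho>'"
    using P unfolding equivalent_rep_def \<rho>'_def by blast
  have gen: "\<rho>' (std_gen p r i) = M" if "(mat 1 + (\<rho> (std_gen p r i) - mat 1)) ** P = P ** M" for i M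
    using mult_conj_matrix_inv[OF P, of "\<rho> (std_gen p r i)" M] that by (simp add: \<rho>'_def)
  have in_S: "\<rho> (std_gen p r i) - mat 1 \<in> S" for i
    unfolding S_def using std_gen_in_carrier by blast
  \<comment> \<open>Choice turns the parameters of each matrix into functions of i. With
    \<open>F\<close> arbitrary this serves forms (1) to (4) and (6), and form (7) once its constants
    are fixed.\<close>
  have three_params: "\<exists>\<alpha> \<beta> \<gamma>. \<forall>i\<in>{1..r}. \<rho>' (std_gen p r i) = F (\<alpha> i) (\<beta> i) (\<gamma> i)"
    if "\<forall>Y\<in>S. \<exists>a b c. (mat 1 + Y) ** P = P ** F a b c" for F :: "'k \<Rightarrow> 'k \<Rightarrow> 'k \<Rightarrow> 'k^4^4"
  proof -
    have "\<forall>i. \<exists>a b c. \<rho>' (std_gen p r i) = F a b c"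
      using that in_S gen by meson
    then show ?thesis by metis
  qed
  have four_params: "\<exists>\<alpha> \<beta> \<gamma> \<delta>. \<forall>i\<in>{1..r}. \<rho>' (std_gen p r i) = F (\<alpha> i) (\<beta> i) (\<gamma> i) (\<delta> i)"
    if "\<forall>Y\<in>S. \<exists>a b c d. (mat 1 + Y) ** P = P ** F a b c d"
    for F :: "'k \<Rightarrow> 'k \<Rightarrow> 'k \<Rightarrow> 'k \<Rightarrow> 'k^4^4"
  proof -
    have "\<forall>i. \<exists>a b c d. \<rho>' (std_gen p r i) = F a b c d"
      using that in_S gen by meson
    then show ?thesis by metis
  qed
  show ?thesis
    by (intro exI[of _ \<rho>'] conjI hom equiv, insert forms,
        elim disj_forward ex_forward conj_forward)
      (assumption | (drule three_params four_params, assumption))+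
qed

end
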